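(* Let $F:\mathbb{R}^n\to\mathbb{R}\cup\{+\infty\}$ be an $\mathbb{R}$-DDM-convex function, and let $f:\mathbb{Z}^n\to\mathbb{R}\cup\{+\infty\}$ be the restriction of $F$ to $\mathbb{Z}^n$. If $F$ has a unique minimizer $\overline{x}$, then there exists $x^*\in\operatorname{argmin} f$ with $\|x^*-\overline{x}\|_\infty\le n$.
   Context: For $x,y\in\mathbb{Z}^n$, the vector $\mu(x,y)\in\mathbb{Z}^n$ is defined componentwise by $\mu(x,y)_i=\lceil (x_i+y_i)/2\rceil$ if $x_i\ge y_i$, and $\mu(x,y)_i=\lfloor (x_i+y_i)/2\rfloor$ if $x_i<y_i$. A function $f:\mathbb{Z}^n\to\mathbb{R}\cup\{+\infty\}$ is called DDM-convex if $f(x)+f(y)\ge f(\mu(x,y))+f(\mu(y,x))$ for all $x,y\in\mathbb{Z}^n$. A continuous convex function $F:\mathbb{R}^n\to\mathbb{R}\cup\{+\infty\}$ (continuous as a map from $\mathbb{R}^n$ into $\mathbb{R}\cup\{+\infty\}$ with its usual topology) is called an $\mathbb{R}$-DDM-convex function if for every positive integer $\alpha$ the function $f^{1/\alpha}:\mathbb{Z}^n\to\mathbb{R}\cup\{+\infty\}$ defined by $f^{1/\alpha}(x)=F(x/\alpha)$ $(x\in\mathbb{Z}^n)$ is DDM-convex. $\operatorname{argmin} f=\{x\in\mathbb{Z}^n\mid f(x)\le f(z)\ \forall z\in\mathbb{Z}^n\}$; a minimizer of $F$ is a point $x\in\mathbb{R}^n$ with $F(x)\le F(z)$ for all $z\in\mathbb{R}^n$.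 *)

theory Defs
  imports "HOL-Analysis.Analysis"
begin

definition of_int_vec :: "int ^ 'n \<Rightarrow> real ^ 'n" where
  "of_int_vec z = (\<chi> i. real_of_int (z $ i))"

definition mu :: "int ^ 'n \<Rightarrow> int ^ 'n \<Rightarrow> int ^ 'n" where
  "mu x y = (\<chi> i. if x $ i \<ge> y $ i
                   then \<lceil>(real_of_int (x $ i) + real_of_int (y $ i)) / 2\<rceil>
                   else \<lfloor>(real_of_int (x $ i) + real_of_int (y $ i)) / 2\<rfloor>)"

text \<open>
  A function with values in the reals extended by plus infinity is an \<^typ>\<open>ereal\<close>-valued
  function that never takes the value minus infinity.
\<close>

definition DDM_convex :: "(int ^ 'n \<Rightarrow> ereal) \<Rightarrow> bool" where
  "DDM_convex f \<longleftrightarrow>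
     (\<forall>x. f x \<noteq> -\<infinity>) \<and>
     (\<forall>x y. f x + f y \<ge> f (mu x y) + f (mu y x))"

text \<open>
  The library's \<^const>\<open>convex_on\<close> covers real-valued functions only. The parameter below is
  strictly between 0 and 1, so no product of 0 and infinity occurs.
\<close>

definition ext_convex :: "('a::real_vector \<Rightarrow> ereal) \<Rightarrow> bool" where
  "ext_convex F \<longleftrightarrow>
     (\<forall>x y. \<forall>t::real. 0 < t \<and> t < 1 \<longrightarrow>
        F ((1 - t) *\<^sub>R x + t *\<^sub>R y) \<le> ereal (1 - t) * F x + ereal t * F y)"

definition R_DDM_convex :: "(real ^ 'n \<Rightarrow> ereal) \<Rightarrow> bool" where
  "R_DDM_convex F \<longleftrightarrow>
     (\<forall>x. F x \<noteq> -\<infinity>) \<and>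
     continuous_on UNIV F \<and>
     ext_convex F \<and>
     (\<forall>\<alpha>::nat. \<alpha> > 0 \<longrightarrow> DDM_convex (\<lambda>x. F (of_int_vec x /\<^sub>R real \<alpha>)))"

definition argmin :: "('a \<Rightarrow> ereal) \<Rightarrow> 'a set" where
  "argmin f = {x. \<forall>z. f x \<le> f z}"

end

theory Submission
  imports Defs
begin

text \<open>
  From any integer point \<open>z\<close> further than \<open>n\<close> from \<open>xbar\<close> one can take an integer step towards
  \<open>xbar\<close> that does not increase \<open>F\<close>. Hence the minimum of \<open>f\<close> over the finitely many integer
  points within distance \<open>n\<close> of \<open>xbar\<close> is its minimum over all integer points.

  The step comes from a pigeonhole argument. The \<open>n\<close> distances \<open>w\<^sub>i = \<bar>xbar\<^sub>i - z\<^sub>i\<bar>\<close>, one of which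
  exceeds \<open>n\<close>, cannot meet all the unit intervals \<open>(k, k + 1)\<close> with \<open>k < n\<close>
  (\<open>empty_unit_gap\<close>). If \<open>(k, k + 1)\<close> is missed, let \<open>d\<close> be the vector of signs of \<open>xbar - z\<close> on the
  coordinates with \<open>w\<^sub>i \<ge> k + 1\<close>, and \<open>0\<close> elsewhere. The parallelogram inequality
  \<open>F z + F xbar \<ge> F (z + d) + F (xbar - d)\<close> then holds, and since \<open>xbar\<close> is a minimizer,
  \<open>F (z + d) \<le> F z\<close> (\<open>R_DDM_step_le\<close>).

  The parallelogram inequality is first proved on the integer lattice
  (\<open>DDM_parallelogram\<close>) and transferred to \<open>F\<close> by approximating \<open>xbar\<close> in the lattices of mesh
  \<open>1 / \<alpha>\<close>. On the lattice, the difference of two points is cut into unit layers: layer \<open>k\<close>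
  moves by one every coordinate whose total displacement exceeds \<open>k\<close>, and adding a set \<open>J\<close> of
  layers to the starting point makes \<open>f\<close> a function of \<open>J\<close>. Directed midpoints amount to
  splitting a set of layers into alternate elements, so DDM-convexity gives one inequality of
  supermodular type for each interval of sets. Such a family of single inequalities already implies
  full supermodularity, also in the presence of infinite values (\<open>supermodular_if_exchange\<close>).
  Taking for \<open>J\<close> the \<open>\<alpha>\<close> consecutive layers that correspond to the gap \<open>(k, k + 1)\<close> gives the
  displacement \<open>\<alpha> d\<close>.
\<close>

section \<open>Supermodularity from one exchange per interval\<close>

text \<open>
  Induction on the size of the interval from \<open>A\<close> to \<open>A \<union> D\<close>. The one given exchange splits \<open>D\<close> into two
  smaller parts \<open>E\<close> and \<open>L\<close>; the induction hypothesis on intervals of these sizes then shows that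
  finiteness at the two ends spreads to all sets in between. With finite values, terms can be
  cancelled, and the inequality for \<open>J\<close> and \<open>K\<close> is the sum of the inequalities for two smaller
  intervals, unless \<open>J\<close> and \<open>K\<close> are singletons; in that case the given exchange is already the
  desired one.
\<close>

lemma supermodular_if_exchange:
  fixes h :: "'b set \<Rightarrow> ereal"
  assumes not_minf: "\<And>A. h A \<noteq> -\<infinity>"
    and exchange: "\<And>A D. finite D \<Longrightarrow> A \<inter> D = {} \<Longrightarrow> 2 \<le> card D \<Longrightarrow>
          \<exists>E L. E \<union> L = D \<and> E \<inter> L = {} \<and> E \<noteq> {} \<and> L \<noteq> {} \<and>
                h (A \<union> E) + h (A \<union> L) \<le> h A + h (A \<union> D)"
    and "finite (J \<union> K)" "A \<inter> (J \<union> K) = {}" "J \<inter> K = {}"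
  shows "h (A \<union> J) + h (A \<union> K) \<le> h A + h (A \<union> (J \<union> K))"
  using assms(3-)
proof (induction "card (J \<union> K)" arbitrary: A J K rule: less_induct)
  case (less J K A)
  let ?D = "J \<union> K"
  have fin: "finite J" "finite K" using less.prems by auto
  have disj: "A \<inter> J = {}" "A \<inter> K = {}" "J \<inter> K = {}" using less.prems by auto
  have IH: "h (P \<union> S) + h (P \<union> T) \<le> h P + h (P \<union> (S \<union> T))"
    if "finite (S \<union> T)" "card (S \<union> T) < card ?D" "P \<inter> (S \<union> T) = {}" "S \<inter> T = {}" for P S T
    using less.hyps[of S T P] that by blast
  have closed: "h (P \<union> S) < \<infinity>"
    if "h P < \<infinity>" "h (P \<union> T) < \<infinity>" "S \<subseteq> T" "finite T" "card T < card ?D" "P \<inter> T = {}" for P S T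
  proof -
    have eq: "S \<union> (T - S) = T" using that by blast
    have "h (P \<union> S) + h (P \<union> (T - S)) \<le> h P + h (P \<union> T)"
      using IH[of S "T - S" P, unfolded eq] that by blast
    also have "\<dots> < \<infinity>" using that by simp
    finally show ?thesis by auto
  qed
  have real_valued: "\<exists>r. h P = ereal r" if "h P < \<infinity>" for P
    using that not_minf[of P] by (cases "h P") auto
  show ?case
  proof (cases "J = {} \<or> K = {} \<or> h A = \<infinity> \<or> h (A \<union> ?D) = \<infinity>")
    case True
    then show ?thesis by (auto simp: add.commute)
  next
    case False
    then have ne: "J \<noteq> {}" "K \<noteq> {}" and top: "h A < \<infinity>" "h (A \<union> ?D) < \<infinity>" by auto
    have cardD: "card ?D = card J + card K" using fin disj by (simp add: card_Un_disjoint)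
    have pos: "card J \<ge> 1" "card K \<ge> 1" using ne fin by (simp_all add: Suc_leI card_gt_0_iff)
    obtain E L where EL: "E \<union> L = ?D" "E \<inter> L = {}" "E \<noteq> {}" "L \<noteq> {}"
        and ineq: "h (A \<union> E) + h (A \<union> L) \<le> h A + h (A \<union> ?D)"
      using exchange[of ?D A] fin disj pos cardD by (metis add_mono finite_UnI less.prems(2) one_add_one)
    have finEL: "finite E" "finite L" using EL(1) fin by (metis finite_Un)+
    have cardEL: "card ?D = card E + card L" using card_Un_disjoint[OF finEL EL(2)] EL(1) by simp
    have posEL: "card E \<ge> 1" "card L \<ge> 1" using EL finEL by (simp_all add: Suc_leI card_gt_0_iff)
    have "h (A \<union> E) + h (A \<union> L) < \<infinity>" using ineq top by (metis ereal_infty_less_eq(1) ereal_plus_eq_PInfty linorder_not_less)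
    then have hEL: "h (A \<union> E) < \<infinity>" "h (A \<union> L) < \<infinity>" by auto
    have AEL: "A \<inter> E = {}" "A \<inter> L = {}" using EL(1) less.prems(2) by blast+
    \<comment> \<open>Reach \<open>A \<union> S\<close> inside the interval from \<open>A \<union> (S \<inter> E)\<close> to \<open>A \<union> (S \<inter> E) \<union> L\<close>, whose ends
      lie in the intervals from \<open>A\<close> to \<open>A \<union> E\<close> and from \<open>A \<union> L\<close> to \<open>A \<union> D\<close>.\<close>
    have dom: "h (A \<union> S) < \<infinity>" if S: "S \<subseteq> ?D" for S
    proof -
      have 1: "h (A \<union> (S \<inter> E)) < \<infinity>"
        by (rule closed[of A E]) (use top hEL finEL AEL cardEL posEL in auto)
      have "(A \<union> L) \<union> E = A \<union> ?D" using EL(1) by blast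
      then have top_E: "h ((A \<union> L) \<union> E) < \<infinity>" using top by simp
      have 2: "h ((A \<union> L) \<union> (S \<inter> E)) < \<infinity>"
        by (rule closed[OF hEL(2) top_E]) (use finEL AEL EL(2) cardEL posEL in auto)
      have "(A \<union> L) \<union> (S \<inter> E) = (A \<union> (S \<inter> E)) \<union> L" by blast
      then have top_L: "h ((A \<union> (S \<inter> E)) \<union> L) < \<infinity>" using 2 by simp
      have "h ((A \<union> (S \<inter> E)) \<union> (S \<inter> L)) < \<infinity>"
        by (rule closed[OF 1 top_L]) (use finEL AEL EL(2) cardEL posEL in auto)
      moreover have "(A \<union> (S \<inter> E)) \<union> (S \<inter> L) = A \<union> S" using S EL(1) by blast
      ultimately show ?thesis by simp
    qed
    \<comment> \<open>Splitting one element \<open>k\<close> off \<open>U\<close> leaves two intervals, above \<open>A\<close> and above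
      \<open>A \<union> (U - {k})\<close>; the second one is smaller than \<open>D\<close> only if \<open>U\<close> is not a singleton.\<close>
    have large: "h (A \<union> U) + h (A \<union> V) \<le> h A + h (A \<union> ?D)"
      if UV: "U \<union> V = ?D" "U \<inter> V = {}" and U2: "card U \<ge> 2" for U V
    proof -
      have finUV: "finite U" "finite V" using UV(1) fin by (metis finite_Un)+
      have cardUV: "card ?D = card U + card V" using card_Un_disjoint[OF finUV UV(2)] UV(1) by simp
      obtain k where k: "k \<in> U" using U2 by fastforce
      have AU: "A \<inter> (U \<union> V) = {}" using UV(1) less.prems(2) by simp
      let ?W = "U - {k}"
      have c1: "card (?W \<union> V) < card ?D"
      proof -
        have "?W \<union> V = ?D - {k}" using UV k by auto
        moreover have "k \<in> ?D" using UV(1) k by auto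
        ultimately show ?thesis using fin by (metis card_Diff1_less finite_UnI)
      qed
      have "card ({k} \<union> V) = 1 + card V"
        using k UV(2) finUV by (subst card_Un_disjoint) auto
      then have c2: "card ({k} \<union> V) < card ?D" using cardUV U2 by simp
      have i1: "h (A \<union> ?W) + h (A \<union> V) \<le> h A + h (A \<union> (?W \<union> V))"
        by (rule IH) (use c1 finUV AU UV(2) in auto)
      have "h ((A \<union> ?W) \<union> {k}) + h ((A \<union> ?W) \<union> V) \<le> h (A \<union> ?W) + h ((A \<union> ?W) \<union> ({k} \<union> V))"
        by (rule IH) (use c2 finUV AU UV(2) k in auto)
      moreover have "(A \<union> ?W) \<union> {k} = A \<union> U" "(A \<union> ?W) \<union> V = A \<union> (?W \<union> V)"
        "(A \<union> ?W) \<union> ({k} \<union> V) = A \<union> ?D" using k UV(1) by auto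
      ultimately have i2: "h (A \<union> U) + h (A \<union> (?W \<union> V)) \<le> h (A \<union> ?W) + h (A \<union> ?D)" by simp
      have "?W \<subseteq> ?D" "?W \<union> V \<subseteq> ?D" "U \<subseteq> ?D" "V \<subseteq> ?D" using UV(1) by auto
      then have "h (A \<union> ?W) < \<infinity>" "h (A \<union> (?W \<union> V)) < \<infinity>" "h (A \<union> U) < \<infinity>" "h (A \<union> V) < \<infinity>"
        using dom by auto
      then obtain w wv u v a b where eqs: "h (A \<union> ?W) = ereal w" "h (A \<union> (?W \<union> V)) = ereal wv"
        "h (A \<union> U) = ereal u" "h (A \<union> V) = ereal v" "h A = ereal a" "h (A \<union> ?D) = ereal b"
        using top real_valued by meson
      show ?thesis using i1 i2 unfolding eqs by simp
    qed
    consider "card J \<ge> 2" | "card K \<ge> 2" | "card J = 1" "card K = 1" using pos by linarith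
    then show ?thesis
    proof cases
      case 1
      then show ?thesis using large[of J K] disj by blast
    next
      case 2
      then show ?thesis using large[of K J] disj by (metis add.commute inf_commute sup_commute)
    next
      case 3
      then obtain p q where pq: "J = {p}" "K = {q}" by (meson card_1_singletonE)
      have sub: "E \<subseteq> {p, q}" "L \<subseteq> {p, q}" using EL(1) pq by auto
      have "(E = J \<and> L = K) \<or> (E = K \<and> L = J)"
        using sub EL(2-4) unfolding pq subset_insert_iff by (auto split: if_splits)
      then show ?thesis using ineq by (auto simp: add.commute)
    qed
  qed
qed
section \<open>The parallelogram inequality for DDM-convex functions\<close>

text \<open>
  The total displacement of the layers in \<open>J\<close>: layer \<open>k\<close> moves coordinate \<open>i\<close> by \<open>s i\<close> if
  \<open>k < c i\<close>. With all layers below the maximum of \<open>c\<close>, coordinate \<open>i\<close> moves by \<open>s i * c i\<close>.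
\<close>

definition staircase :: "('n \<Rightarrow> int) \<Rightarrow> ('n \<Rightarrow> nat) \<Rightarrow> nat set \<Rightarrow> int ^ 'n" where
  "staircase s c J = (\<chi> i. s i * int (card (J \<inter> {..<c i})))"

lemma staircase_empty [simp]: "staircase s c {} = 0"
  by (simp add: staircase_def vec_eq_iff)

lemma staircase_Un:
  assumes "J \<inter> K = {}"
  shows "staircase s c (J \<union> K) = staircase s c J + staircase s c K"
proof -
  have "card ((J \<union> K) \<inter> {..<m}) = card (J \<inter> {..<m}) + card (K \<inter> {..<m})" for m
    using assms by (subst card_Un_disjoint[symmetric]) (auto simp: Int_Un_distrib2)
  then show ?thesis by (simp add: staircase_def vec_eq_iff algebra_simps)
qed

text \<open>
  Every second element of \<open>D\<close>, starting from its second smallest one. Truncating at any height halves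
  the count with the rounding that \<^const>\<open>mu\<close> performs on a coordinate.
\<close>

definition odd_ranks :: "nat set \<Rightarrow> nat set" where
  "odd_ranks D = {k \<in> D. odd (card (D \<inter> {..<k}))}"

lemma card_odd_ranks_below: "card (odd_ranks D \<inter> {..<m}) = card (D \<inter> {..<m}) div 2"
proof (induction m)
  case (Suc m)
  have split: "X \<inter> {..<Suc m} = (if m \<in> X then insert m (X \<inter> {..<m}) else X \<inter> {..<m})" for X
    by (auto simp: less_Suc_eq)
  show ?case
  proof (cases "m \<in> D")
    case True
    then show ?thesis using Suc by (auto simp: split odd_ranks_def)
  next
    case False
    then have "m \<notin> odd_ranks D" by (simp add: odd_ranks_def)
    then show ?thesis using Suc False by (simp add: split)
  qed
qed simp

text \<open>
  Directed rounding goes towards the first argument. In terms of layers this means: \<open>\<lfloor>m / 2\<rfloor>\<close> of the \<open>m\<close>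
  layers acting on a coordinate are added to \<open>x\<close>, and the choice of these layers can be made once for
  all coordinates.
\<close>

lemma mu_staircase:
  fixes x :: "int ^ 'n"
  assumes s: "\<And>i. s i = 1 \<or> s i = -1"
  shows "mu x (x + staircase s c D) = x + staircase s c (odd_ranks D)"
    and "mu (x + staircase s c D) x = x + staircase s c (D - odd_ranks D)"
proof -
  have half: "\<lceil>(2 * real_of_int a + real m) / 2\<rceil> = a + int m - int (m div 2)"
    "\<lfloor>(2 * real_of_int a + real m) / 2\<rfloor> = a + int (m div 2)"
    "\<lceil>(2 * real_of_int a - real m) / 2\<rceil> = a - int (m div 2)"
    "\<lfloor>(2 * real_of_int a - real m) / 2\<rfloor> = a - int m + int (m div 2)" for a m
  proof -
    have "m = 2 * (m div 2) \<or> m = 2 * (m div 2) + 1" by presburger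
    then have "real m = 2 * real (m div 2) \<or> real m = 2 * real (m div 2) + 1"
      by (metis of_nat_1 of_nat_add of_nat_mult of_nat_numeral)
    then show "\<lceil>(2 * real_of_int a + real m) / 2\<rceil> = a + int m - int (m div 2)"
      "\<lfloor>(2 * real_of_int a + real m) / 2\<rfloor> = a + int (m div 2)"
      "\<lceil>(2 * real_of_int a - real m) / 2\<rceil> = a - int (m div 2)"
      "\<lfloor>(2 * real_of_int a - real m) / 2\<rfloor> = a - int m + int (m div 2)"
      unfolding ceiling_eq_iff floor_eq_iff of_int_add of_int_diff of_int_of_nat_eq by argo+
  qed
  have sub: "odd_ranks D \<subseteq> D" by (auto simp: odd_ranks_def)
  have "staircase s c D = staircase s c (odd_ranks D) + staircase s c (D - odd_ranks D)"
    using staircase_Un[of "odd_ranks D" "D - odd_ranks D"] sub by (simp add: Un_absorb1)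
  then have rest: "staircase s c (D - odd_ranks D) = staircase s c D - staircase s c (odd_ranks D)"
    by simp
  have "mu x (x + staircase s c D) $ i = (x + staircase s c (odd_ranks D)) $ i" for i
    using s[of i] half[of "x $ i" "card (D \<inter> {..<c i})"]
    by (auto simp: mu_def staircase_def card_odd_ranks_below algebra_simps)
  then show "mu x (x + staircase s c D) = x + staircase s c (odd_ranks D)"
    by (simp add: vec_eq_iff)
  have "mu (x + staircase s c D) x $ i
      = (x + (staircase s c D - staircase s c (odd_ranks D))) $ i" for i
    using s[of i] half[of "x $ i" "card (D \<inter> {..<c i})"]
    by (auto simp: mu_def staircase_def card_odd_ranks_below algebra_simps)
  then show "mu (x + staircase s c D) x = x + staircase s c (D - odd_ranks D)"
    by (simp add: vec_eq_iff rest)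
qed

text \<open>
  The function taking a set of layers to the value of \<open>f\<close> at the displaced point satisfies the exchange
  condition, the exchange being the split into alternate layers.
\<close>

lemma DDM_parallelogram:
  fixes f :: "int ^ 'n \<Rightarrow> ereal"
  assumes f: "DDM_convex f" and s: "\<And>i. s i = 1 \<or> s i = -1"
    and JK: "finite (J \<union> K)" "J \<inter> K = {}"
  shows "f (x + staircase s c J) + f (x + staircase s c K) \<le> f x + f (x + staircase s c (J \<union> K))"
proof -
  define h where "h = (\<lambda>J. f (x + staircase s c J))"
  have "h ({} \<union> J) + h ({} \<union> K) \<le> h {} + h ({} \<union> (J \<union> K))"
  proof (rule supermodular_if_exchange)
    show "h A \<noteq> -\<infinity>" for A using f by (simp add: h_def DDM_convex_def)
  next
    fix A D :: "nat set"
    assume D: "finite D" "A \<inter> D = {}" "2 \<le> card D"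
    let ?E = "odd_ranks D"
    have sub: "?E \<subseteq> D" by (auto simp: odd_ranks_def)
    obtain m where "D \<subseteq> {..<m}" using D(1) finite_nat_iff_bounded by blast
    then have cE: "card ?E = card D div 2"
      using card_odd_ranks_below[of D m] sub by (simp add: Int_absorb2)
    have ne: "?E \<noteq> {}" using cE D(3) by auto
    have ne': "D - ?E \<noteq> {}" using cE D(3) sub by auto
    have *: "x + staircase s c (A \<union> S) = (x + staircase s c A) + staircase s c S" if "S \<subseteq> D" for S
    proof -
      have "A \<inter> S = {}" using D(2) that by blast
      then show ?thesis by (simp add: staircase_Un add.assoc)
    qed
    have "f (mu p q) + f (mu q p) \<le> f p + f q" for p q using f by (simp add: DDM_convex_def)
    from this[of "x + staircase s c A" "(x + staircase s c A) + staircase s c D"]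
    have "h (A \<union> ?E) + h (A \<union> (D - ?E)) \<le> h A + h (A \<union> D)"
      using sub by (simp add: h_def * mu_staircase[OF s])
    then show "\<exists>E L. E \<union> L = D \<and> E \<inter> L = {} \<and> E \<noteq> {} \<and> L \<noteq> {} \<and>
        h (A \<union> E) + h (A \<union> L) \<le> h A + h (A \<union> D)"
      using ne ne' sub by (intro exI[of _ ?E] exI[of _ "D - ?E"]) auto
  qed (use JK in auto)
  then show ?thesis by (simp add: h_def)
qed
section \<open>Descent towards a minimizer of the continuous function\<close>

definition gap_step :: "int ^ 'n \<Rightarrow> real ^ 'n \<Rightarrow> nat \<Rightarrow> int ^ 'n" where
  "gap_step z y k = (\<chi> i. if real k + 1 \<le> \<bar>y $ i - of_int (z $ i)\<bar>
                       then (if of_int (z $ i) \<le> y $ i then 1 else -1) else 0)"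

text \<open>
  In the lattice of mesh \<open>1 / \<alpha>\<close>, approximate \<open>xbar\<close> by the point \<open>y \<alpha>\<close> obtained from \<open>z\<close> by rounding the
  displacements down to \<open>c \<alpha> i / \<alpha>\<close>. The gap ensures that the layers from \<open>\<alpha> k\<close> to \<open>\<alpha> k + \<alpha> - 1\<close>
  act either all or not at all on a given coordinate. Together they form exactly the integer step,
  and the parallelogram inequality compares \<open>z\<close> with the point after this step; bounding the
  fourth term below by \<open>F xbar\<close> leaves \<open>F (y \<alpha>)\<close>, which tends to \<open>F xbar\<close>.
\<close>

lemma R_DDM_step_le:
  fixes F :: "real ^ 'n \<Rightarrow> ereal"
  assumes F: "R_DDM_convex F" and min: "\<And>y. F xbar \<le> F y" and fin: "F xbar < \<infinity>"
    and gap: "\<And>i. \<bar>xbar $ i - of_int (z $ i)\<bar> \<le> real k \<or> real k + 1 \<le> \<bar>xbar $ i - of_int (z $ i)\<bar>"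
  shows "F (of_int_vec (z + gap_step z xbar k)) \<le> F (of_int_vec z)"
proof (cases "F (of_int_vec z) = \<infinity>")
  case False
  define w where "w i = \<bar>xbar $ i - of_int (z $ i)\<bar>" for i
  define s :: "'n \<Rightarrow> int" where "s i = (if of_int (z $ i) \<le> xbar $ i then 1 else -1)" for i
  define c where "c \<alpha> i = nat \<lfloor>real \<alpha> * w i\<rfloor>" for \<alpha> :: nat and i
  define y where "y \<alpha> = (\<chi> i. of_int (z $ i) + of_int (s i) * real (c \<alpha> i) / real \<alpha>)" for \<alpha> :: nat
  have s1: "s i = 1 \<or> s i = -1" for i by (simp add: s_def)
  have xbar: "xbar $ i = of_int (z $ i) + of_int (s i) * w i" for i
    by (simp add: w_def s_def)
  have main: "F (of_int_vec (z + gap_step z xbar k)) + F xbar \<le> F (of_int_vec z) + F (y \<alpha>)"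
    if \<alpha>: "\<alpha> > 0" for \<alpha>
  proof -
    define x :: "int ^ 'n" where "x = (\<chi> i. int \<alpha> * z $ i)"
    define J where "J = {\<alpha> * k..<\<alpha> * k + \<alpha>}"
    define M where "M = (\<Sum>i\<in>UNIV. c \<alpha> i)"
    define f where "f p = F (of_int_vec p /\<^sub>R real \<alpha>)" for p
    have cM: "c \<alpha> i \<le> M" for i unfolding M_def by (rule member_le_sum) auto
    have "f (x + staircase s (c \<alpha>) J) + f (x + staircase s (c \<alpha>) ({..<M} - J))
        \<le> f x + f (x + staircase s (c \<alpha>) (J \<union> ({..<M} - J)))"
      by (rule DDM_parallelogram)
        (use F \<alpha> s1 in \<open>auto simp: R_DDM_convex_def f_def J_def\<close>)
    moreover have "f x = F (of_int_vec z)"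
    proof -
      have "of_int_vec x /\<^sub>R real \<alpha> = of_int_vec z"
        using \<alpha> by (simp add: vec_eq_iff of_int_vec_def x_def field_simps)
      then show ?thesis by (simp add: f_def)
    qed
    moreover have "f (x + staircase s (c \<alpha>) J) = F (of_int_vec (z + gap_step z xbar k))"
    proof -
      have "card (J \<inter> {..<c \<alpha> i}) = (if real k + 1 \<le> w i then \<alpha> else 0)" for i
      proof (cases "real k + 1 \<le> w i")
        case True
        then have "real (\<alpha> * k + \<alpha>) \<le> real \<alpha> * w i"
          using \<alpha> mult_left_mono[of "real k + 1" "w i" "real \<alpha>"] by (simp add: algebra_simps)
        then have "\<alpha> * k + \<alpha> \<le> c \<alpha> i" unfolding c_def by (simp add: le_nat_floor)
        then have "J \<inter> {..<c \<alpha> i} = J" by (auto simp: J_def)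
        then show ?thesis using True by (simp add: J_def)
      next
        case False
        then have "w i \<le> real k" using gap[of i] by (simp add: w_def)
        then have "real \<alpha> * w i \<le> real (\<alpha> * k)" by (simp add: mult_left_mono)
        then have "c \<alpha> i \<le> \<alpha> * k" unfolding c_def by linarith
        then have "J \<inter> {..<c \<alpha> i} = {}" by (auto simp: J_def)
        then show ?thesis using False by simp
      qed
      then have "of_int_vec (x + staircase s (c \<alpha>) J) /\<^sub>R real \<alpha> = of_int_vec (z + gap_step z xbar k)"
        using \<alpha> by (auto simp: vec_eq_iff of_int_vec_def x_def staircase_def gap_step_def s_def w_def
            field_simps)
      then show ?thesis by (simp add: f_def)
    qed
    moreover have "f (x + staircase s (c \<alpha>) (J \<union> ({..<M} - J))) = F (y \<alpha>)"
    proof -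
      have "(J \<union> ({..<M} - J)) \<inter> {..<c \<alpha> i} = {..<c \<alpha> i}" for i using cM[of i] by auto
      then have "of_int_vec (x + staircase s (c \<alpha>) (J \<union> ({..<M} - J))) /\<^sub>R real \<alpha> = y \<alpha>"
        using \<alpha> by (simp add: vec_eq_iff of_int_vec_def x_def staircase_def y_def field_simps)
      then show ?thesis by (simp add: f_def)
    qed
    moreover have "F xbar \<le> f (x + staircase s (c \<alpha>) ({..<M} - J))" by (simp add: f_def min)
    ultimately show ?thesis by (metis add_left_mono order_trans)
  qed
  have "(\<lambda>n. real (c (Suc n) i) / real (Suc n)) \<longlonglongrightarrow> w i" for i
  proof (rule tendsto_sandwich)
    have w: "w i \<ge> 0" by (simp add: w_def)
    have "w i - 1 / real (Suc n) \<le> real (c (Suc n) i) / real (Suc n) \<and>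
        real (c (Suc n) i) / real (Suc n) \<le> w i" for n
    proof -
      have "real (Suc n) * w i - 1 \<le> real (c (Suc n) i)" "real (c (Suc n) i) \<le> real (Suc n) * w i"
        using w unfolding c_def by (simp_all add: mult_nonneg_nonneg del: of_nat_Suc)
      from this[THEN divide_right_mono, of "real (Suc n)"] show ?thesis
        by (simp add: diff_divide_distrib del: of_nat_Suc)
    qed
    then show "\<forall>\<^sub>F n in sequentially. w i - 1 / real (Suc n) \<le> real (c (Suc n) i) / real (Suc n)"
      "\<forall>\<^sub>F n in sequentially. real (c (Suc n) i) / real (Suc n) \<le> w i" by auto
    show "(\<lambda>n. w i - 1 / real (Suc n)) \<longlonglongrightarrow> w i"
      using tendsto_diff[OF tendsto_const[of "w i"] LIMSEQ_inverse_real_of_nat] by (simp add: inverse_eq_divide)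
  qed simp
  then have "(\<lambda>n. of_int (z $ i) + of_int (s i) * (real (c (Suc n) i) / real (Suc n)))
      \<longlonglongrightarrow> of_int (z $ i) + of_int (s i) * w i" for i
    by (intro tendsto_add tendsto_mult tendsto_const)
  then have "(\<lambda>n. y (Suc n) $ i) \<longlonglongrightarrow> xbar $ i" for i
    by (simp only: y_def xbar vec_lambda_beta times_divide_eq_right)
  then have "(\<lambda>n. y (Suc n)) \<longlonglongrightarrow> xbar" by (rule vec_tendstoI)
  moreover have "isCont F xbar"
    using F by (simp add: R_DDM_convex_def continuous_on_eq_continuous_at)
  ultimately have lim: "(\<lambda>n. F (y (Suc n))) \<longlonglongrightarrow> F xbar"
    by (rule isCont_tendsto_compose[rotated])
  have real: "\<bar>F (of_int_vec z)\<bar> \<noteq> \<infinity>" "\<bar>F xbar\<bar> \<noteq> \<infinity>"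
    using F fin False by (auto simp: R_DDM_convex_def)
  have "F (of_int_vec (z + gap_step z xbar k)) + F xbar \<le> F (of_int_vec z) + F xbar"
    by (rule LIMSEQ_le_const[OF tendsto_add_ereal[OF real tendsto_const lim]]) (use main in auto)
  then show ?thesis using real(2) by (auto simp: ereal_add_le_add_iff2)
qed simp

text \<open>
  The large value \<open>w i0\<close> lies above all the intervals \<open>(k, k + 1)\<close> with \<open>k < n\<close>, so the other
  \<open>n - 1\<close> values cannot meet all \<open>n\<close> of them.
\<close>

lemma empty_unit_gap:
  fixes w :: "'n::finite \<Rightarrow> real"
  assumes "w i0 > real CARD('n)"
  obtains k where "k < CARD('n)" "\<And>i. w i \<le> real k \<or> real k + 1 \<le> w i"
proof -
  have "card ((\<lambda>i. nat \<lfloor>w i\<rfloor>) ` (UNIV - {i0})) \<le> card (UNIV - {i0})" by (rule card_image_le) simp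
  also have "\<dots> < card {..<CARD('n)}" by (simp add: card_Diff_subset)
  finally have "\<not> {..<CARD('n)} \<subseteq> (\<lambda>i. nat \<lfloor>w i\<rfloor>) ` (UNIV - {i0})"
    by (meson card_mono finite finite_imageI not_le)
  then obtain k where k: "k < CARD('n)" "k \<notin> (\<lambda>i. nat \<lfloor>w i\<rfloor>) ` (UNIV - {i0})" by blast
  have "w i \<le> real k \<or> real k + 1 \<le> w i" for i
  proof (cases "i = i0")
    case True
    then show ?thesis using assms k(1) by auto
  next
    case False
    then have "nat \<lfloor>w i\<rfloor> \<noteq> k" using k(2) by auto
    then show ?thesis by linarith
  qed
  then show ?thesis using k(1) that by blast
qed

lemma infnorm_le_iff: "infnorm x \<le> r \<longleftrightarrow> (\<forall>i. \<bar>x $ i\<bar> \<le> r)" for x :: "real ^ 'n"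
  unfolding infnorm_Max by (subst Max_le_iff) (auto simp: Basis_vec_def inner_axis)

text \<open>
  Each step moves the affected coordinates by exactly one towards \<open>xbar\<close> without overshooting and
  affects the farthest one, so the sum of the rounded-down distances strictly decreases.
\<close>

lemma descent_into_ball:
  fixes F :: "real ^ 'n \<Rightarrow> ereal"
  assumes F: "R_DDM_convex F" and min: "\<And>y. F xbar \<le> F y" and fin: "F xbar < \<infinity>"
  shows "\<exists>p. infnorm (of_int_vec p - xbar) \<le> real CARD('n) \<and> F (of_int_vec p) \<le> F (of_int_vec z)"
proof (induction "\<Sum>i\<in>UNIV. nat \<lfloor>\<bar>xbar $ i - of_int (z $ i)\<bar>\<rfloor>" arbitrary: z rule: less_induct)
  case (less z)
  let ?w = "\<lambda>z i. \<bar>xbar $ i - of_int (z $ i)\<bar>"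
  show ?case
  proof (cases "infnorm (of_int_vec z - xbar) \<le> real CARD('n)")
    case False
    then obtain i0 where i0: "?w z i0 > real CARD('n)"
      by (auto simp: infnorm_le_iff of_int_vec_def abs_minus_commute not_le)
    then obtain k where k: "k < CARD('n)" and gap: "\<And>i. ?w z i \<le> real k \<or> real k + 1 \<le> ?w z i"
      using empty_unit_gap[of "?w z" i0] by blast
    let ?p = "z + gap_step z xbar k"
    have le: "nat \<lfloor>?w ?p i\<rfloor> \<le> nat \<lfloor>?w z i\<rfloor>" for i
      by (intro nat_mono floor_mono) (auto simp: gap_step_def)
    have "?w ?p i0 = ?w z i0 - 1" using i0 k by (auto simp: gap_step_def)
    then have "nat \<lfloor>?w ?p i0\<rfloor> < nat \<lfloor>?w z i0\<rfloor>" using i0 k by linarith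
    then have "(\<Sum>i\<in>UNIV. nat \<lfloor>?w ?p i\<rfloor>) < (\<Sum>i\<in>UNIV. nat \<lfloor>?w z i\<rfloor>)"
      using le by (intro sum_strict_mono_ex1) auto
    from less[OF this] obtain p where "infnorm (of_int_vec p - xbar) \<le> real CARD('n)"
      "F (of_int_vec p) \<le> F (of_int_vec ?p)" by blast
    then show ?thesis using R_DDM_step_le[OF F min fin gap] order_trans by blast
  qed auto
qed

lemma finite_int_ball: "finite {p. infnorm (of_int_vec p - x) \<le> r}" for x :: "real ^ 'n"
proof (rule finite_subset)
  let ?I = "\<lambda>i. {\<lceil>x $ i - r\<rceil>..\<lfloor>x $ i + r\<rfloor>}"
  show "{p. infnorm (of_int_vec p - x) \<le> r} \<subseteq> vec_lambda ` Pi\<^sub>E UNIV ?I"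
  proof
    fix p assume "p \<in> {p. infnorm (of_int_vec p - x) \<le> r}"
    then have "\<bar>of_int (p $ i) - x $ i\<bar> \<le> r" for i by (simp add: infnorm_le_iff of_int_vec_def)
    then have "x $ i - r \<le> of_int (p $ i) \<and> of_int (p $ i) \<le> x $ i + r" for i
      using abs_le_D1 abs_le_D2 by (smt (verit))
    then have "vec_nth p \<in> Pi\<^sub>E UNIV ?I" by (auto simp: ceiling_le_iff le_floor_iff)
    then show "p \<in> vec_lambda ` Pi\<^sub>E UNIV ?I" by (rule image_eqI[rotated]) (simp add: vec_nth_inverse)
  qed
  show "finite (vec_lambda ` Pi\<^sub>E UNIV ?I)" by (intro finite_imageI finite_PiE) auto
qed

theorem theorem9p2:
  fixes F :: "real ^ 'n \<Rightarrow> ereal"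
    and f :: "int ^ 'n \<Rightarrow> ereal"
    and xbar :: "real ^ 'n"
  assumes "R_DDM_convex F"
    and "f = (\<lambda>x. F (of_int_vec x))"
    and "argmin F = {xbar}"
  shows "\<exists>xstar \<in> argmin f. infnorm (of_int_vec xstar - xbar) \<le> real CARD('n)"
proof -
  have min: "F xbar \<le> F y" for y using assms(3) by (auto simp: argmin_def)
  \<comment> \<open>Otherwise \<open>F\<close> is constantly infinite and every point is a minimizer.\<close>
  have fin: "F xbar < \<infinity>"
  proof (rule ccontr)
    assume "\<not> F xbar < \<infinity>"
    then have "F y = \<infinity>" for y using min[of y] by auto
    then have "xbar + 1 \<in> argmin F" by (simp add: argmin_def)
    then show False using assms(3) by (simp add: vec_eq_iff)
  qed
  let ?B = "{p. infnorm (of_int_vec p - xbar) \<le> real CARD('n)}"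
  have ball: "\<exists>p\<in>?B. f p \<le> f z" for z
    using descent_into_ball[OF assms(1) min fin] assms(2) by auto
  then have "?B \<noteq> {}" by blast
  then obtain p where p: "is_arg_min f (\<lambda>p. p \<in> ?B) p"
    using ex_is_arg_min_if_finite[OF finite_int_ball] by blast
  then have "p \<in> ?B" "\<And>q. q \<in> ?B \<Longrightarrow> f p \<le> f q" by (auto simp: is_arg_min_linorder)
  then have "p \<in> argmin f" using ball order_trans unfolding argmin_def by blast
  then show ?thesis using \<open>p \<in> ?B\<close> by blast
qed

end
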